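(* Let $d,p\in\mathbb{N}$, $\Omega\subset\mathbb{R}^d$, $a\geq 0$, and let $X_N=\{x_1,\dots,x_N\}\subset\Omega$ be a set of $N\leq M_a$ pairwise distinct points. Let $\{\zeta^{(1)},\dots,\zeta^{(M_a)}\}$ be an enumeration of $I_a(p,d)$ and let $V:=\left[x_i^{\zeta^{(j)}}\right]_{1\le i\le N,\,1\le j\le M_a}\in\mathbb{R}^{N\times M_a}$. Then the kernel matrix $A=(k_{a,p}(x_i,x_j))_{i,j=1}^N$ is invertible (and thus positive definite) if and only if $V$ has full row rank $N$. In particular, this is the case if and only if there exists a set $X_{M_a}\subset\mathbb{R}^d$ of $M_a$ points such that $X_N\subset X_{M_a}$ and $X_{M_a}$ is $\mathbb{P}_p^d$-unisolvent if $a>0$, or $\mathbb{H}_p^d$-unisolvent if $a=0$.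
   Context: The polynomial kernel is $k_{a,p}(x,y):=(a+\langle x,y\rangle)^p$ for $x,y\in\mathbb{R}^d$, with the Euclidean inner product. $\mathbb{P}_p^d$ is the space of real polynomials on $\mathbb{R}^d$ of total degree at most $p$; $\mathbb{H}_p^d$ is the space of homogeneous polynomials of degree $p$ on $\mathbb{R}^d$. For a multi-index $\zeta\in\mathbb{N}_0^d$, $|\zeta|=\zeta_1+\dots+\zeta_d$ and $x^\zeta=\prod_i x_i^{\zeta_i}$ (for a point $x_i\in X_N$, $x_i^{\zeta}$ is the monomial evaluated at that point). $I_a(p,d):=\{\zeta\in\mathbb{N}_0^d: |\zeta|\le p\}$ if $a>0$ and $I_0(p,d):=\{\zeta\in\mathbb{N}_0^d: |\zeta|=p\}$; $M_a$ is the cardinality of $I_a(p,d)$, i.e. $M_a=\binom{d+p}{d}=\dim\mathbb{P}_p^d$ if $a>0$ and $M_0=\binom{d-1+p}{d-1}=\dim\mathbb{H}_p^d$. For a finite-dimensional linear space $U$ of real functions, a set of $\dim(U)$ points $X$ is called $U$-unisolvent if the only $u\in U$ with $u|_X=0$ is $u=0$. *)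

theory Defs
  imports
    "HOL-Analysis.Analysis"
    "HOL-Library.Function_Algebras"
    "Jordan_Normal_Form.DL_Rank"
begin

text \<open>
  Points of \<open>\<real>\<^sup>d\<close> are elements of \<open>real ^ 'd\<close>; matrices, whose sizes are natural numbers,
  are those of Jordan_Normal_Form, with rows and columns indexed from 0. Both libraries
  use the same infix symbols for vector components and inner products, so
  \<open>vec_nth\<close>, \<open>inner\<close> (for points) and \<open>scalar_prod\<close> (for coefficient vectors) are
  written out.
\<close>

subsection \<open>Monomials and polynomial spaces\<close>

definition abs_idx :: "('d::finite \<Rightarrow> nat) \<Rightarrow> nat" where
  "abs_idx \<zeta> = (\<Sum>i\<in>UNIV. \<zeta> i)"

definition monomial :: "('d::finite \<Rightarrow> nat) \<Rightarrow> real ^ 'd \<Rightarrow> real" where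
  "monomial \<zeta> x = (\<Prod>i\<in>UNIV. vec_nth x i ^ \<zeta> i)"

definition polys :: "nat \<Rightarrow> (real ^ 'd::finite \<Rightarrow> real) set" where
  "polys p = {u. \<exists>c. \<forall>x. u x = (\<Sum>\<zeta> | abs_idx \<zeta> \<le> p. c \<zeta> * monomial \<zeta> x)}"

definition homog_polys :: "nat \<Rightarrow> (real ^ 'd::finite \<Rightarrow> real) set" where
  "homog_polys p = {u. \<exists>c. \<forall>x. u x = (\<Sum>\<zeta> | abs_idx \<zeta> = p. c \<zeta> * monomial \<zeta> x)}"

definition idx_set :: "real \<Rightarrow> nat \<Rightarrow> ('d::finite \<Rightarrow> nat) set" where
  "idx_set a p = (if a > 0 then {\<zeta>. abs_idx \<zeta> \<le> p} else {\<zeta>. abs_idx \<zeta> = p})"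

text \<open>The index sets are finite, so the sums above and the cardinality of
  \<open>idx_set a p\<close> are not the default values for infinite sets.\<close>

lemma finite_abs_idx_le: "finite {\<zeta> :: 'd::finite \<Rightarrow> nat. abs_idx \<zeta> \<le> p}"
proof (rule finite_subset)
  show "{\<zeta> :: 'd \<Rightarrow> nat. abs_idx \<zeta> \<le> p} \<subseteq> PiE UNIV (\<lambda>_. {..p})"
  proof
    fix \<zeta> :: "'d \<Rightarrow> nat" assume "\<zeta> \<in> {\<zeta>. abs_idx \<zeta> \<le> p}"
    then have "\<zeta> i \<le> p" for i
      using member_le_sum[of i UNIV \<zeta>] by (simp add: abs_idx_def)
    then show "\<zeta> \<in> PiE UNIV (\<lambda>_. {..p})" by (simp add: PiE_def)
  qed
  show "finite (PiE (UNIV :: 'd set) (\<lambda>_. {..p}))" by (intro finite_PiE) auto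
qed

lemma finite_idx_set: "finite (idx_set a p :: ('d::finite \<Rightarrow> nat) set)"
  unfolding idx_set_def
  by (auto intro: finite_subset[OF _ finite_abs_idx_le[where p = p]])

subsection \<open>Unisolvent sets\<close>

interpretation real_fun: vector_space "\<lambda>(c::real) (f::'b \<Rightarrow> real) x. c * f x"
  by unfold_locales (auto simp: fun_eq_iff algebra_simps)

definition unisolvent :: "('b \<Rightarrow> real) set \<Rightarrow> 'b set \<Rightarrow> bool" where
  "unisolvent U X \<longleftrightarrow>
     finite X \<and> card X = real_fun.dim U \<and>
     (\<forall>u\<in>U. (\<forall>x\<in>X. u x = 0) \<longrightarrow> u = (\<lambda>_. 0))"

subsection \<open>Kernel matrix and monomial matrix\<close>

definition poly_kernel :: "real \<Rightarrow> nat \<Rightarrow> real ^ 'd::finite \<Rightarrow> real ^ 'd \<Rightarrow> real" where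
  "poly_kernel a p x y = (a + inner x y) ^ p"

definition kernel_mat :: "('b \<Rightarrow> 'b \<Rightarrow> real) \<Rightarrow> nat \<Rightarrow> (nat \<Rightarrow> 'b) \<Rightarrow> real mat" where
  "kernel_mat k N x = Matrix.mat N N (\<lambda>(i, j). k (x i) (x j))"

definition monomial_mat ::
  "nat \<Rightarrow> nat \<Rightarrow> (nat \<Rightarrow> real ^ 'd::finite) \<Rightarrow> (nat \<Rightarrow> 'd \<Rightarrow> nat) \<Rightarrow> real mat" where
  "monomial_mat N M x \<zeta> = Matrix.mat N M (\<lambda>(i, j). monomial (\<zeta> j) (x i))"

definition pos_def_mat :: "real mat \<Rightarrow> bool" where
  "pos_def_mat A \<longleftrightarrow>
     square_mat A \<and> transpose_mat A = A \<and>
     (\<forall>v\<in>carrier_vec (dim_row A). v \<noteq> 0\<^sub>v (dim_row A) \<longrightarrow> scalar_prod v (A *\<^sub>v v) > 0)"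

end

theory Submission
  imports Defs
begin

text \<open>
  By the multinomial theorem, \<open>poly_kernel a p x y\<close> is a combination of the products
  \<open>monomial \<zeta> x * monomial \<zeta> y\<close>, \<open>\<zeta> \<in> idx_set a p\<close>, with strictly positive weights
  (lemma \<open>poly_kernel_eq_pos_sum_monomials\<close>). So \<open>A = V D V\<^sup>T\<close> with a positive diagonal matrix
  \<open>D\<close>, and the equivalences for \<open>A\<close> form a cycle (lemma \<open>kernel_mat_feature_expansion\<close>).
  If \<open>A\<close> is invertible, then \<open>D V\<^sup>T A\<^sup>-\<^sup>1\<close> is a right inverse of \<open>V\<close>, and \<open>V\<close> has rank \<open>N\<close>.
  If \<open>V\<close> has rank \<open>N\<close>, then its left kernel is trivial, that is, the evaluations at the
  points are linearly independent functionals on the span of the monomials. In that case the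
  quadratic form \<open>v\<^sup>T A v\<close>, a weighted sum of squares of the entries of \<open>V\<^sup>T v\<close>, is positive
  definite. A positive definite matrix is invertible.

  For the unisolvent sets, only one fact of linear algebra is used: fewer equations than unknowns
  have a nontrivial solution (lemma \<open>lin_indep_on_card_le\<close>). It says that as long as there are
  fewer points than monomials, some nonzero combination of monomials vanishes at all the points;
  as a function it is not zero, because monomials are linearly independent, so it is nonzero at
  some further point, whose evaluation is then independent of the others. Adding such points
  one at a time ends with as many points as monomials. For such a set, independence of the
  evaluations and unisolvence are equivalent, being the triviality of the left and of the right
  kernel of a square matrix.
\<close>

section \<open>Linear independence of functions on a set and of evaluations\<close>

text \<open>
  A function \<open>f\<close> of two arguments is a matrix with rows and columns indexed by arbitrary sets.
  Then \<open>lin_indep_on f I X\<close> says that the functions \<open>f i\<close>, restricted to \<open>X\<close>, are linearly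
  independent as a family, and \<open>lin_indep_on (\<lambda>x i. f i x) X I\<close> that the evaluations at the
  points of \<open>X\<close> are linearly independent on the span of the family.
\<close>

definition lin_indep_on :: "('i \<Rightarrow> 'b \<Rightarrow> 'a::field) \<Rightarrow> 'i set \<Rightarrow> 'b set \<Rightarrow> bool" where
  "lin_indep_on f I X \<longleftrightarrow>
     (\<forall>c. (\<forall>x\<in>X. (\<Sum>i\<in>I. c i * f i x) = 0) \<longrightarrow> (\<forall>i\<in>I. c i = 0))"

lemma lin_indep_onI:
  assumes "\<And>c i. (\<And>x. x \<in> X \<Longrightarrow> (\<Sum>i\<in>I. c i * f i x) = 0) \<Longrightarrow> i \<in> I \<Longrightarrow> c i = 0"
  shows "lin_indep_on f I X"
  using assms unfolding lin_indep_on_def by blast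

lemma lin_indep_onD:
  assumes "lin_indep_on f I X" "\<And>x. x \<in> X \<Longrightarrow> (\<Sum>i\<in>I. c i * f i x) = 0" "i \<in> I"
  shows "c i = 0"
  using assms unfolding lin_indep_on_def by blast

lemma lin_indep_on_subset:
  assumes "lin_indep_on f I X" "J \<subseteq> I" "finite I"
  shows "lin_indep_on f J X"
proof (rule lin_indep_onI)
  fix c j assume c: "\<And>x. x \<in> X \<Longrightarrow> (\<Sum>i\<in>J. c i * f i x) = 0" and j: "j \<in> J"
  let ?c = "\<lambda>i. if i \<in> J then c i else 0"
  have "(\<Sum>i\<in>I. ?c i * f i x) = (\<Sum>i\<in>J. c i * f i x)" for x
    using assms by (intro sum.mono_neutral_cong_right) auto
  then have "?c j = 0" using lin_indep_onD[OF assms(1), of ?c j] c j assms(2) by auto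
  then show "c j = 0" using j by simp
qed

text \<open>
  Gaussian elimination: a point \<open>y\<close> where some \<open>f m\<close> is nonzero is removed by subtracting
  multiples of \<open>f m\<close>, which makes all the other functions vanish at \<open>y\<close>.
\<close>

lemma lin_indep_on_card_le:
  assumes "finite X" "finite I" "lin_indep_on f I X"
  shows "card I \<le> card X"
  using assms
proof (induction X arbitrary: I f rule: finite_induct)
  case empty
  then have "I = {}" unfolding lin_indep_on_def by (auto dest: spec[of _ "\<lambda>_. 1"])
  then show ?case by simp
next
  case (insert y X)
  show ?case
  proof (cases "\<forall>i\<in>I. f i y = 0")
    case True
    then have "lin_indep_on f I X"
      using insert.prems(2) unfolding lin_indep_on_def by simp
    with insert show ?thesis by (simp add: le_SucI)
  next
    case False
    then obtain m where m: "m \<in> I" "f m y \<noteq> 0" by auto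
    define g where "g i x = f i x - f i y / f m y * f m x" for i x
    have "lin_indep_on g (I - {m}) X"
    proof (rule lin_indep_onI)
      fix c i assume c: "\<And>x. x \<in> X \<Longrightarrow> (\<Sum>i\<in>I - {m}. c i * g i x) = 0" and i: "i \<in> I - {m}"
      \<comment> \<open>A relation between the reduced functions is one between the original functions; the
        coefficient of \<open>f m\<close> collects the subtracted multiples.\<close>
      define e where "e i = (if i = m then - (\<Sum>i\<in>I - {m}. c i * f i y) / f m y else c i)" for i
      have expand: "(\<Sum>i\<in>I. e i * f i x) = (\<Sum>i\<in>I - {m}. c i * g i x)" for x
      proof -
        have "(\<Sum>i\<in>I. e i * f i x) = e m * f m x + (\<Sum>i\<in>I - {m}. e i * f i x)"
          by (rule sum.remove[OF insert.prems(1) m(1)])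
        also have "(\<Sum>i\<in>I - {m}. e i * f i x) = (\<Sum>i\<in>I - {m}. c i * f i x)"
          by (intro sum.cong) (auto simp: e_def)
        also have "e m * f m x = - (\<Sum>i\<in>I - {m}. c i * (f i y / f m y * f m x))"
          by (simp add: e_def sum_distrib_right sum_divide_distrib mult.assoc)
        finally show ?thesis by (simp add: g_def algebra_simps sum_subtractf)
      qed
      have "g i y = 0" for i using m by (simp add: g_def)
      then have "(\<Sum>i\<in>I. e i * f i x) = 0" if "x \<in> insert y X" for x
        using that c by (auto simp: expand)
      from lin_indep_onD[OF insert.prems(2) this] i have "e i = 0" by blast
      then show "c i = 0" using i by (simp add: e_def)
    qed
    then have "card (I - {m}) \<le> card X" using insert by blast
    then show ?thesis using m insert by (simp add: card_Diff_singleton)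
  qed
qed

text \<open>
  If the evaluations satisfied a relation involving the point \<open>y\<close>, then a combination of the
  functions that vanishes at all other points would vanish at \<open>y\<close> as well. So the functions
  would stay independent on fewer points than there are functions.
\<close>

lemma lin_indep_on_transpose:
  assumes "finite I" "finite X" "card I = card X" "lin_indep_on f I X"
  shows "lin_indep_on (\<lambda>x i. f i x) X I"
proof (rule lin_indep_onI, rule ccontr)
  fix v y assume v: "\<And>i. i \<in> I \<Longrightarrow> (\<Sum>x\<in>X. v x * f i x) = 0" and y: "y \<in> X" "v y \<noteq> 0"
  have "lin_indep_on f I (X - {y})"
  proof (rule lin_indep_onI)
    fix c i assume c: "\<And>x. x \<in> X - {y} \<Longrightarrow> (\<Sum>i\<in>I. c i * f i x) = 0" and i: "i \<in> I"
    define u where "u x = (\<Sum>i\<in>I. c i * f i x)" for x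
    have "(\<Sum>x\<in>X. v x * u x) = (\<Sum>i\<in>I. c i * (\<Sum>x\<in>X. v x * f i x))"
      unfolding u_def sum_distrib_left by (subst sum.swap) (simp add: mult_ac)
    also have "\<dots> = 0" using v by simp
    finally have "v y * u y + (\<Sum>x\<in>X - {y}. v x * u x) = 0"
      using sum.remove[OF assms(2) y(1), of "\<lambda>x. v x * u x"] by simp
    moreover have "(\<Sum>x\<in>X - {y}. v x * u x) = 0" using c by (intro sum.neutral) (simp add: u_def)
    ultimately have "u y = 0" using y by simp
    then have "(\<Sum>i\<in>I. c i * f i x) = 0" if "x \<in> X" for x
      using c[of x] that by (cases "x = y") (auto simp: u_def)
    then show "c i = 0" using lin_indep_onD[OF assms(4)] i by blast
  qed
  then have "card I \<le> card (X - {y})"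
    using assms(1,2) by (intro lin_indep_on_card_le) auto
  then show False using assms y card_Diff1_less[of X y] by simp
qed

text \<open>
  As long as there are too few points, some combination \<open>u\<close> of the functions vanishes on \<open>X\<close>
  but not everywhere. A point \<open>y\<close> with \<open>u y \<noteq> 0\<close> may be added: applying a relation between the
  evaluations to \<open>u\<close> shows that the coefficient of \<open>y\<close> is zero.
\<close>

lemma lin_indep_on_extend_points:
  assumes "finite I" "lin_indep_on f I UNIV" "finite X" "lin_indep_on (\<lambda>x i. f i x) X I"
  shows "\<exists>Y. X \<subseteq> Y \<and> finite Y \<and> card Y = card I \<and> lin_indep_on (\<lambda>x i. f i x) Y I"
  using assms(3,4)
proof (induction "card I - card X" arbitrary: X rule: less_induct)
  case less
  have le: "card X \<le> card I" using lin_indep_on_card_le[OF assms(1) less.prems] .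
  show ?case
  proof (cases "card X = card I")
    case True
    then show ?thesis using less.prems by blast
  next
    case False
    then have "\<not> lin_indep_on f I X"
      using lin_indep_on_card_le[OF less.prems(1) assms(1)] le by force
    then obtain c i where c: "\<And>x. x \<in> X \<Longrightarrow> (\<Sum>i\<in>I. c i * f i x) = 0" and i: "i \<in> I" "c i \<noteq> 0"
      unfolding lin_indep_on_def by blast
    define u where "u x = (\<Sum>i\<in>I. c i * f i x)" for x
    obtain y where y: "u y \<noteq> 0"
      using lin_indep_onD[OF assms(2), of c i] i unfolding u_def by blast
    then have yX: "y \<notin> X" using c by (auto simp: u_def)
    have "lin_indep_on (\<lambda>x i. f i x) (insert y X) I"
    proof (rule lin_indep_onI)
      fix v z assume v: "\<And>i. i \<in> I \<Longrightarrow> (\<Sum>x\<in>insert y X. v x * f i x) = 0" and z: "z \<in> insert y X"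
      have "(\<Sum>x\<in>insert y X. v x * u x) = (\<Sum>i\<in>I. c i * (\<Sum>x\<in>insert y X. v x * f i x))"
        unfolding u_def sum_distrib_left by (subst sum.swap) (simp add: mult_ac)
      also have "\<dots> = 0" using v by simp
      finally have "v y * u y + (\<Sum>x\<in>X. v x * u x) = 0" using less.prems(1) yX by simp
      moreover have "(\<Sum>x\<in>X. v x * u x) = 0" using c by (intro sum.neutral) (simp add: u_def)
      ultimately have vy: "v y = 0" using y by simp
      have "(\<Sum>x\<in>X. v x * f i x) = 0" if "i \<in> I" for i
        using v[OF that] less.prems(1) yX vy by simp
      then show "v z = 0" using lin_indep_onD[OF less.prems(2), of v z] vy z by auto
    qed
    moreover have "card I - card (insert y X) < card I - card X"
      using less.prems(1) yX le False by simp
    ultimately obtain Y where "insert y X \<subseteq> Y" "finite Y" "card Y = card I"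
        "lin_indep_on (\<lambda>x i. f i x) Y I"
      using less.hyps[of "insert y X"] less.prems(1) by auto
    then show ?thesis by blast
  qed
qed

text \<open>
  On the right-hand side the independence of the evaluations has become that of the functions,
  which is the defining property of a unisolvent set.
\<close>

lemma lin_indep_evals_iff_extension:
  assumes "finite I" "lin_indep_on f I UNIV" "finite X"
  shows "lin_indep_on (\<lambda>x i. f i x) X I \<longleftrightarrow>
    (\<exists>Y. X \<subseteq> Y \<and> finite Y \<and> card Y = card I \<and> lin_indep_on f I Y)"
proof
  assume "lin_indep_on (\<lambda>x i. f i x) X I"
  from lin_indep_on_extend_points[OF assms this] obtain Y
    where "X \<subseteq> Y" "finite Y" "card Y = card I" "lin_indep_on (\<lambda>x i. f i x) Y I" by blast
  then show "\<exists>Y. X \<subseteq> Y \<and> finite Y \<and> card Y = card I \<and> lin_indep_on f I Y"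
    using lin_indep_on_transpose[of Y I "\<lambda>x i. f i x"] assms by auto
next
  assume "\<exists>Y. X \<subseteq> Y \<and> finite Y \<and> card Y = card I \<and> lin_indep_on f I Y"
  then obtain Y where Y: "X \<subseteq> Y" "finite Y" "card Y = card I" "lin_indep_on f I Y" by blast
  from lin_indep_on_transpose[OF assms(1) Y(2) Y(3)[symmetric] Y(4)]
  show "lin_indep_on (\<lambda>x i. f i x) X I"
    using Y(1,2) by (rule lin_indep_on_subset)
qed

section \<open>Unisolvent sets\<close>

lemma sum_fun_apply: "(\<Sum>i\<in>I. g i) x = (\<Sum>i\<in>I. g i x :: real)"
  by (induction I rule: infinite_finite_induct) auto

text \<open>
  Global independence of the \<open>f i\<close> has two uses: it gives the dimension of their span, and it
  identifies the zero function with the zero coefficients.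
\<close>

lemma unisolvent_iff_lin_indep_on:
  fixes f :: "'i \<Rightarrow> 'b \<Rightarrow> real"
  assumes fin: "finite I" and indep: "lin_indep_on f I UNIV"
    and U: "U = {u. \<exists>c. \<forall>x. u x = (\<Sum>i\<in>I. c i * f i x)}"
  shows "unisolvent U X \<longleftrightarrow> finite X \<and> card X = card I \<and> lin_indep_on f I X"
proof -
  have inj: "inj_on f I"
  proof (rule inj_onI, rule ccontr)
    fix i j assume ij: "i \<in> I" "j \<in> I" "f i = f j" "i \<noteq> j"
    define c :: "'i \<Rightarrow> real" where "c k = (if k = i then 1 else 0) - (if k = j then 1 else 0)" for k
    have "c k * f k x = (if k = i then f k x else 0) - (if k = j then f k x else 0)" for k x
      by (simp add: c_def)
    then have "(\<Sum>k\<in>I. c k * f k x) = 0" for x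
      using ij fin by (simp add: sum_subtractf)
    then have "c i = 0" using lin_indep_onD[OF indep] ij by blast
    then show False using ij by (simp add: c_def)
  qed
  have "real_fun.dim U = card (f ` I)"
  proof (rule real_fun.dim_unique[of "f ` I"])
    show "f ` I \<subseteq> U"
    proof
      fix g assume "g \<in> f ` I"
      then obtain i where i: "i \<in> I" "g = f i" by blast
      have "(if k = i then 1 else 0) * f k x = (if k = i then f k x else 0)" for k x
        by simp
      then have "g x = (\<Sum>k\<in>I. (if k = i then 1 else 0) * f k x)" for x
        using i fin by simp
      then show "g \<in> U" unfolding U by (intro CollectI exI[of _ "\<lambda>k. if k = i then 1 else 0"] allI)
    qed
    show "U \<subseteq> real_fun.span (f ` I)"
    proof
      fix u assume "u \<in> U"
      then obtain c where "\<forall>x. u x = (\<Sum>i\<in>I. c i * f i x)" unfolding U by blast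
      then have u: "u = (\<Sum>i\<in>I. (\<lambda>x. c i * f i x))" by (auto simp: sum_fun_apply)
      have "(\<lambda>x. c i * f i x) \<in> real_fun.span (f ` I)" if "i \<in> I" for i
        using real_fun.span_scale[OF real_fun.span_base[of "f i" "f ` I"], of "c i"] that by simp
      then show "u \<in> real_fun.span (f ` I)" unfolding u by (rule real_fun.span_sum)
    qed
    show "real_fun.independent (f ` I)"
    proof (rule real_fun.independent_if_scalars_zero)
      show "finite (f ` I)" using fin by simp
      fix c g assume c: "(\<Sum>g\<in>f ` I. (\<lambda>x. c g * g x)) = 0" and g: "g \<in> f ` I"
      from g obtain i where i: "i \<in> I" "g = f i" by blast
      have "(\<Sum>i\<in>I. c (f i) * f i x) = 0" for x
        using fun_cong[OF c, of x] inj by (simp add: sum_fun_apply sum.reindex)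
      then show "c g = 0" using lin_indep_onD[OF indep, of "\<lambda>i. c (f i)" i] i by simp
    qed
  qed simp
  then have dim: "real_fun.dim U = card I" using inj by (simp add: card_image)
  have "(\<forall>u\<in>U. (\<forall>x\<in>X. u x = 0) \<longrightarrow> u = (\<lambda>_. 0)) \<longleftrightarrow> lin_indep_on f I X" (is "?L \<longleftrightarrow> ?R")
  proof
    assume L: ?L
    show ?R
    proof (rule lin_indep_onI)
      fix c i assume c: "\<And>x. x \<in> X \<Longrightarrow> (\<Sum>i\<in>I. c i * f i x) = 0" and i: "i \<in> I"
      have "(\<lambda>x. \<Sum>i\<in>I. c i * f i x) \<in> U" unfolding U by blast
      from bspec[OF L this] c have "(\<lambda>x. \<Sum>i\<in>I. c i * f i x) = (\<lambda>_. 0)" by simp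
      then have "(\<Sum>i\<in>I. c i * f i x) = 0" for x by (rule fun_cong)
      then show "c i = 0" using lin_indep_onD[OF indep, of c i] i by simp
    qed
  next
    assume R: ?R
    show ?L
    proof (intro ballI impI)
      fix u assume "u \<in> U" and 0: "\<forall>x\<in>X. u x = 0"
      then obtain c where c: "\<And>x. u x = (\<Sum>i\<in>I. c i * f i x)" unfolding U by blast
      have "c i = 0" if "i \<in> I" for i using lin_indep_onD[OF R, of c i] 0 c that by simp
      then show "u = (\<lambda>_. 0)" by (simp add: fun_eq_iff c)
    qed
  qed
  then show ?thesis unfolding unisolvent_def dim by blast
qed

section \<open>Monomials are linearly independent functions\<close>

lemma monomial_times:
  "monomial \<zeta> (\<chi> i. vec_nth x i * vec_nth y i) = monomial \<zeta> x * monomial \<zeta> y"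
  by (simp add: monomial_def power_mult_distrib prod.distrib)

lemma monomial_ones: "monomial \<zeta> (\<chi> i. 1) = 1"
  by (simp add: monomial_def)

lemma monomial_separates:
  fixes \<zeta> \<eta> :: "'d::finite \<Rightarrow> nat"
  assumes "\<zeta> \<noteq> \<eta>"
  obtains y where "monomial \<zeta> y \<noteq> monomial \<eta> y"
proof -
  obtain i where i: "\<zeta> i \<noteq> \<eta> i" using assms by blast
  \<comment> \<open>At this point a monomial only sees the exponent of the coordinate \<open>i\<close>.\<close>
  define y :: "real ^ 'd" where "y = (\<chi> j. if j = i then 2 else 1)"
  have "monomial \<theta> y = 2 ^ \<theta> i" for \<theta>
  proof -
    have "monomial \<theta> y = (\<Prod>j\<in>UNIV. if j = i then 2 ^ \<theta> j else 1)"
      unfolding monomial_def y_def by (intro prod.cong) auto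
    then show ?thesis by simp
  qed
  with i have "monomial \<zeta> y \<noteq> monomial \<eta> y" by simp
  then show thesis by (rule that)
qed

text \<open>
  Artin's argument for the independence of characters: monomials are multiplicative for the
  entrywise product of points. Given a relation involving \<open>\<eta>\<close>, replacing \<open>x\<close> by its product with
  \<open>y\<close> and subtracting \<open>monomial \<eta> y\<close> times the relation eliminates \<open>\<eta>\<close> and multiplies every
  other coefficient by a difference that is nonzero for suitable \<open>y\<close>.
\<close>

lemma lin_indep_monomials:
  fixes I :: "('d::finite \<Rightarrow> nat) set"
  assumes "finite I"
  shows "lin_indep_on monomial I UNIV"
  using assms
proof (induction I rule: finite_induct)
  case empty
  show ?case by (simp add: lin_indep_on_def)
next
  case (insert \<eta> I)
  show ?case
  proof (rule lin_indep_onI)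
    fix c \<zeta>
    assume "\<And>x. x \<in> UNIV \<Longrightarrow> (\<Sum>\<zeta>\<in>insert \<eta> I. c \<zeta> * monomial \<zeta> x) = 0"
      and \<zeta>: "\<zeta> \<in> insert \<eta> I"
    then have rel: "c \<eta> * monomial \<eta> x + (\<Sum>\<zeta>\<in>I. c \<zeta> * monomial \<zeta> x) = 0" for x
      using insert.hyps by simp
    then have S: "(\<Sum>\<zeta>\<in>I. c \<zeta> * monomial \<zeta> x) = - (c \<eta> * monomial \<eta> x)" for x
      by (simp add: eq_neg_iff_add_eq_0 add.commute)
    have I0: "c \<theta> = 0" if \<theta>: "\<theta> \<in> I" for \<theta>
    proof -
      obtain y where y: "monomial \<theta> y \<noteq> monomial \<eta> y"
        using monomial_separates[of \<theta> \<eta>] \<theta> insert.hyps by blast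
      have "(\<Sum>\<zeta>\<in>I. (c \<zeta> * (monomial \<zeta> y - monomial \<eta> y)) * monomial \<zeta> x) = 0" for x
      proof -
        have "(\<Sum>\<zeta>\<in>I. (c \<zeta> * (monomial \<zeta> y - monomial \<eta> y)) * monomial \<zeta> x)
            = (\<Sum>\<zeta>\<in>I. c \<zeta> * monomial \<zeta> (\<chi> i. vec_nth x i * vec_nth y i))
              - monomial \<eta> y * (\<Sum>\<zeta>\<in>I. c \<zeta> * monomial \<zeta> x)"
          by (simp add: monomial_times algebra_simps sum_subtractf sum_distrib_left)
        also have "\<dots> = 0"
          by (subst S, subst S) (simp add: monomial_times)
        finally show ?thesis .
      qed
      then have "c \<theta> * (monomial \<theta> y - monomial \<eta> y) = 0"
        using lin_indep_onD[OF insert.IH, of "\<lambda>\<zeta>. c \<zeta> * (monomial \<zeta> y - monomial \<eta> y)" \<theta>] \<theta> by blast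
      then show ?thesis using y by simp
    qed
    then have "c \<eta> = 0" using rel[of "\<chi> i. 1"] by (simp add: monomial_ones)
    then show "c \<zeta> = 0" using I0 \<zeta> by blast
  qed
qed

section \<open>The kernel as a positive combination of products of monomials\<close>

lemma abs_idx_fun_upd_Suc: "abs_idx (\<zeta>(i := Suc (\<zeta> i))) = Suc (abs_idx \<zeta>)"
  by (simp add: abs_idx_def sum.remove[of UNIV i])

lemma monomial_fun_upd_Suc: "monomial (\<zeta>(i := Suc (\<zeta> i))) z = vec_nth z i * monomial \<zeta> z"
  by (simp add: monomial_def prod.remove[of UNIV i])

lemma finite_abs_idx_eq: "finite {\<zeta> :: 'd::finite \<Rightarrow> nat. abs_idx \<zeta> = p}"
  by (rule finite_subset[OF _ finite_abs_idx_le[of p]]) auto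

text \<open>
  The multinomial theorem, without the value of the coefficients, since only their sign matters.
  Multiplying by another factor \<open>\<Sum>i. z\<^sub>i\<close> raises one exponent, so the new
  coefficient of \<open>\<eta>\<close> is the sum of the old ones over all ways to lower a nonzero entry of \<open>\<eta>\<close>.
\<close>

lemma power_sum_eq_pos_sum_monomials:
  "\<exists>w. (\<forall>\<zeta>. abs_idx \<zeta> = p \<longrightarrow> w \<zeta> > 0) \<and>
     (\<forall>z :: real ^ 'd::finite.
        (\<Sum>i\<in>UNIV. vec_nth z i) ^ p = (\<Sum>\<zeta> | abs_idx \<zeta> = p. w \<zeta> * monomial \<zeta> z))"
proof (induction p)
  case 0
  have "{\<zeta> :: 'd \<Rightarrow> nat. abs_idx \<zeta> = 0} = {\<lambda>_. 0}" by (auto simp: abs_idx_def)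
  then show ?case by (intro exI[of _ "\<lambda>_. 1"]) (simp add: monomial_def)
next
  case (Suc p)
  then obtain w :: "('d \<Rightarrow> nat) \<Rightarrow> real" where pos: "\<And>\<zeta>. abs_idx \<zeta> = p \<Longrightarrow> w \<zeta> > 0"
    and w: "\<And>z. (\<Sum>i\<in>UNIV. vec_nth z i) ^ p = (\<Sum>\<zeta> | abs_idx \<zeta> = p. w \<zeta> * monomial \<zeta> z)"
    by blast
  define w' where "w' \<eta> = (\<Sum>i | 0 < \<eta> i. w (\<eta>(i := \<eta> i - 1)))" for \<eta>
  have down: "abs_idx (\<eta>(i := \<eta> i - Suc 0)) = p" if "abs_idx \<eta> = Suc p" "0 < \<eta> i" for \<eta> :: "'d \<Rightarrow> nat" and i
    using abs_idx_fun_upd_Suc[of "\<eta>(i := \<eta> i - 1)" i] that by simp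
  have "w' \<eta> > 0" if \<eta>: "abs_idx \<eta> = Suc p" for \<eta>
  proof -
    have "\<exists>i. 0 < \<eta> i"
    proof (rule ccontr)
      assume "\<not> (\<exists>i. 0 < \<eta> i)"
      then have "abs_idx \<eta> = 0" by (simp add: abs_idx_def)
      then show False using \<eta> by simp
    qed
    then show ?thesis unfolding w'_def using \<eta> by (intro sum_pos) (auto intro!: pos down)
  qed
  moreover have "(\<Sum>i\<in>UNIV. vec_nth z i) ^ Suc p = (\<Sum>\<eta> | abs_idx \<eta> = Suc p. w' \<eta> * monomial \<eta> z)"
    for z :: "real ^ 'd"
  proof -
    have "(\<Sum>i\<in>UNIV. vec_nth z i) ^ Suc p
        = (\<Sum>i\<in>UNIV. \<Sum>\<zeta> | abs_idx \<zeta> = p. w \<zeta> * monomial (\<zeta>(i := Suc (\<zeta> i))) z)"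
      by (simp add: w sum_product monomial_fun_upd_Suc mult_ac)
    also have "\<dots> = (\<Sum>i\<in>UNIV. \<Sum>\<eta> | \<eta> \<in> {\<eta>. abs_idx \<eta> = Suc p} \<and> 0 < \<eta> i. w (\<eta>(i := \<eta> i - 1)) * monomial \<eta> z)"
    proof (rule sum.cong[OF refl])
      fix i :: 'd
      show "(\<Sum>\<zeta> | abs_idx \<zeta> = p. w \<zeta> * monomial (\<zeta>(i := Suc (\<zeta> i))) z)
          = (\<Sum>\<eta> | \<eta> \<in> {\<eta>. abs_idx \<eta> = Suc p} \<and> 0 < \<eta> i. w (\<eta>(i := \<eta> i - 1)) * monomial \<eta> z)"
        by (rule sum.reindex_bij_witness[of _ "\<lambda>\<eta>. \<eta>(i := \<eta> i - 1)" "\<lambda>\<zeta>. \<zeta>(i := Suc (\<zeta> i))"])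
          (auto simp: abs_idx_fun_upd_Suc down)
    qed
    also have "\<dots> = (\<Sum>\<eta> | abs_idx \<eta> = Suc p. \<Sum>i | i \<in> UNIV \<and> 0 < \<eta> i. w (\<eta>(i := \<eta> i - 1)) * monomial \<eta> z)"
      by (rule sum.swap_restrict) (auto simp: finite_abs_idx_eq)
    finally show ?thesis by (simp add: w'_def sum_distrib_right)
  qed
  ultimately show ?case by blast
qed

text \<open>
  The inner product is the sum of the entries of the entrywise product, so its powers expand into
  products of monomials. For \<open>a > 0\<close>, the binomial theorem contributes every degree up to \<open>p\<close>
  with positive coefficients; for \<open>a = 0\<close> only degree \<open>p\<close> remains.
\<close>

lemma poly_kernel_eq_pos_sum_monomials:
  assumes "a \<ge> 0"
  shows "\<exists>w. (\<forall>\<zeta>\<in>idx_set a p. w \<zeta> > 0) \<and>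
    (\<forall>x y :: real ^ 'd::finite.
       poly_kernel a p x y = (\<Sum>\<zeta>\<in>idx_set a p. w \<zeta> * (monomial \<zeta> x * monomial \<zeta> y)))"
proof -
  obtain W :: "nat \<Rightarrow> ('d \<Rightarrow> nat) \<Rightarrow> real"
    where W_pos: "\<And>k \<zeta>. abs_idx \<zeta> = k \<Longrightarrow> W k \<zeta> > 0"
      and W: "\<And>k z. (\<Sum>i\<in>UNIV. vec_nth z i) ^ k = (\<Sum>\<zeta> | abs_idx \<zeta> = k. W k \<zeta> * monomial \<zeta> z)"
    using power_sum_eq_pos_sum_monomials[where 'd = 'd] by metis
  have inner_power: "inner x y ^ k = (\<Sum>\<zeta> | abs_idx \<zeta> = k. W k \<zeta> * (monomial \<zeta> x * monomial \<zeta> y))"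
    for x y :: "real ^ 'd" and k
    using W[of "\<chi> i. vec_nth x i * vec_nth y i" k] by (simp add: inner_vec_def monomial_times)
  show ?thesis
  proof (cases "a > 0")
    case False
    with assms have "a = 0" by simp
    then show ?thesis
      by (intro exI[of _ "W p"]) (simp add: idx_set_def poly_kernel_def inner_power W_pos)
  next
    case True
    define w where "w \<zeta> = real (p choose abs_idx \<zeta>) * a ^ (p - abs_idx \<zeta>) * W (abs_idx \<zeta>) \<zeta>" for \<zeta>
    have "poly_kernel a p x y = (\<Sum>\<zeta> | abs_idx \<zeta> \<le> p. w \<zeta> * (monomial \<zeta> x * monomial \<zeta> y))"
      for x y :: "real ^ 'd"
    proof -
      have "poly_kernel a p x y = (\<Sum>k\<le>p. real (p choose k) * inner x y ^ k * a ^ (p - k))"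
        by (simp add: poly_kernel_def add.commute[of a] binomial_ring)
      also have "\<dots> = (\<Sum>k\<le>p. \<Sum>\<zeta> | \<zeta> \<in> {\<zeta>. abs_idx \<zeta> \<le> p} \<and> abs_idx \<zeta> = k. w \<zeta> * (monomial \<zeta> x * monomial \<zeta> y))"
      proof (rule sum.cong[OF refl])
        fix k assume "k \<in> {..p}"
        then have "{\<zeta>. \<zeta> \<in> {\<zeta> :: 'd \<Rightarrow> nat. abs_idx \<zeta> \<le> p} \<and> abs_idx \<zeta> = k} = {\<zeta>. abs_idx \<zeta> = k}" by auto
        then show "real (p choose k) * inner x y ^ k * a ^ (p - k) =
            (\<Sum>\<zeta> | \<zeta> \<in> {\<zeta>. abs_idx \<zeta> \<le> p} \<and> abs_idx \<zeta> = k. w \<zeta> * (monomial \<zeta> x * monomial \<zeta> y))"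
          by (simp add: inner_power w_def sum_distrib_left sum_distrib_right mult_ac)
      qed
      also have "\<dots> = (\<Sum>\<zeta> | abs_idx \<zeta> \<le> p. w \<zeta> * (monomial \<zeta> x * monomial \<zeta> y))"
        by (rule sum.group) (auto simp: finite_abs_idx_le)
      finally show ?thesis .
    qed
    moreover have "w \<zeta> > 0" if "abs_idx \<zeta> \<le> p" for \<zeta>
      using that True by (simp add: w_def W_pos)
    ultimately show ?thesis using True by (intro exI[of _ w]) (simp add: idx_set_def)
  qed
qed

section \<open>Kernel matrices of positive feature expansions\<close>

lemma (in vec_space) rank_eq_n_iff_col_space:
  assumes A: "A \<in> carrier_mat n nc"
  shows "rank A = n \<longleftrightarrow> col_space A = carrier_vec n"
proof
  have cols: "set (cols A) \<subseteq> carrier_vec n" using cols_dim A by blast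
  {
    assume "rank A = n"
    obtain S where S: "maximal S (\<lambda>T. T \<subseteq> set (cols A) \<and> lin_indpt T)"
      using maximal_exists_superset[of "set (cols A)" "\<lambda>T. T \<subseteq> set (cols A) \<and> lin_indpt T" "{}"]
        finite_lin_indpt2[of "{}"] by auto
    then have sub: "S \<subseteq> set (cols A)" and li: "lin_indpt S" by (auto simp: maximal_def)
    have "card S = n" using rank_card_indpt[OF A S] \<open>rank A = n\<close> by simp
    then have "basis S"
      using dim_li_is_basis[of S] sub cols li finite_subset[OF sub] by (auto simp: dim_is_n)
    then have "span S = carrier_vec n" by (simp add: basis_def)
    moreover have "span S \<subseteq> span (set (cols A))" using sub by (rule span_is_monotone)
    moreover have "span (set (cols A)) \<subseteq> carrier_vec n" using span_closed cols by auto
    ultimately show "col_space A = carrier_vec n" by (simp add: col_space_def)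
  next
    assume "col_space A = carrier_vec n"
    moreover have "vs (carrier_vec n) = V" by (simp add: module_vec_def)
    ultimately show "rank A = n" by (simp only: rank_def col_space_def dim_is_n)
  }
qed

lemma rank_eq_dim_row_if_right_inverse:
  fixes A :: "'a::field mat"
  assumes "A \<in> carrier_mat n nc" "B \<in> carrier_mat nc n" "A * B = 1\<^sub>m n"
  shows "vec_space.rank n A = n"
proof -
  interpret vec_space "TYPE('a)" n .
  have "\<exists>v\<in>carrier_vec nc. A *\<^sub>v v = y" if y: "y \<in> carrier_vec n" for y
  proof
    show "A *\<^sub>v (B *\<^sub>v y) = y"
      using assms y assoc_mult_mat_vec[OF assms(1,2) y] by simp
  qed (rule mult_mat_vec_carrier[OF assms(2) y])
  then have "col_space A = carrier_vec n" using col_space_eq[OF assms(1)] assms(1) by auto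
  then show ?thesis using rank_eq_n_iff_col_space[OF assms(1)] by simp
qed

lemma invertible_mat_if_pos_def_mat:
  assumes "pos_def_mat A"
  shows "invertible_mat A"
proof -
  let ?n = "dim_row A"
  have A: "A \<in> carrier_mat ?n ?n" using assms by (auto simp: pos_def_mat_def)
  have "Determinant.det A \<noteq> 0"
  proof
    assume "Determinant.det A = 0"
    then obtain v where "v \<in> carrier_vec ?n" "v \<noteq> 0\<^sub>v ?n" "A *\<^sub>v v = 0\<^sub>v ?n"
      using det_0_iff_vec_prod_zero[OF A] by blast
    then show False using assms unfolding pos_def_mat_def by force
  qed
  from det_non_zero_imp_unit[OF A this, of "()"]
  obtain B where B: "B \<in> carrier_mat ?n ?n" "A * B = 1\<^sub>m ?n" "B * A = 1\<^sub>m ?n"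
    by (auto simp: Units_def ring_mat_def)
  have "dim_row B = ?n" using B(1) by (rule carrier_matD)
  with B have "inverts_mat A B" "inverts_mat B A" by (simp_all only: inverts_mat_def)
  moreover have "square_mat A" using assms by (simp only: pos_def_mat_def)
  ultimately show ?thesis unfolding invertible_mat_def by blast
qed

text \<open>
  Positivity of the weights is what makes the quadratic form a sum of squares; invertibility could
  fail for a full-rank \<open>V\<close> if the weights had mixed signs.
\<close>

lemma kernel_mat_feature_expansion:
  fixes f :: "'i \<Rightarrow> 'b \<Rightarrow> real"
  assumes pos: "\<And>i. i \<in> I \<Longrightarrow> w i > 0"
    and k: "\<And>x y. k x y = (\<Sum>i\<in>I. w i * (f i x * f i y))"
    and \<zeta>: "bij_betw \<zeta> {..<M} I"
    and inj: "inj_on x {..<N}"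
  defines "A \<equiv> kernel_mat k N x"
    and "V \<equiv> Matrix.mat N M (\<lambda>(i, j). f (\<zeta> j) (x i))"
  shows "invertible_mat A \<longleftrightarrow> vec_space.rank N V = N"
    and "invertible_mat A \<longleftrightarrow> lin_indep_on (\<lambda>y i. f i y) (x ` {..<N}) I"
    and "invertible_mat A \<longleftrightarrow> pos_def_mat A"
proof -
  have V: "V \<in> carrier_mat N M" and A: "A \<in> carrier_mat N N"
    by (auto simp: V_def A_def kernel_mat_def)
  have finI: "finite I" using \<zeta> bij_betw_finite by blast
  have reindex: "(\<Sum>j<M. h (\<zeta> j)) = (\<Sum>i\<in>I. h i)" for h :: "'i \<Rightarrow> real"
    by (rule sum.reindex_bij_betw[OF \<zeta>])
  have 1: "vec_space.rank N V = N" if inv: "invertible_mat A"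
  proof -
    define W where "W = Matrix.mat M N (\<lambda>(j, i). w (\<zeta> j) * f (\<zeta> j) (x i))"
    have W: "W \<in> carrier_mat M N" by (simp add: W_def)
    have "A = V * W"
    proof (rule eq_matI)
      fix m n assume "m < dim_row (V * W)" "n < dim_col (V * W)"
      then have mn: "m < N" "n < N" using V W by auto
      then have "(V * W) $$ (m, n) = (\<Sum>j<M. f (\<zeta> j) (x m) * (w (\<zeta> j) * f (\<zeta> j) (x n)))"
        by (simp add: V_def W_def scalar_prod_def atLeast0LessThan)
      also have "\<dots> = (\<Sum>i\<in>I. f i (x m) * (w i * f i (x n)))" by (rule reindex)
      finally show "A $$ (m, n) = (V * W) $$ (m, n)"
        using mn by (simp add: A_def kernel_mat_def k mult_ac)
    qed (use A V W in auto)
    obtain B where B: "A * B = 1\<^sub>m (dim_row A)" "B * A = 1\<^sub>m (dim_row B)"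
      using inv unfolding invertible_mat_def inverts_mat_def by blast
    have "dim_row B = N" "dim_col B = N"
      using arg_cong[OF B(2), of dim_col] arg_cong[OF B(1), of dim_col] A by auto
    then have Bc: "B \<in> carrier_mat N N" by auto
    then have "V * (W * B) = 1\<^sub>m N"
      using B(1) A V assoc_mult_mat[OF V W Bc] \<open>A = V * W\<close> by simp
    then show ?thesis using rank_eq_dim_row_if_right_inverse[OF V, of "W * B"] W Bc by auto
  qed
  have 2: "lin_indep_on (\<lambda>y i. f i y) (x ` {..<N}) I" if rank: "vec_space.rank N V = N"
  proof (rule lin_indep_onI)
    fix v y assume v: "\<And>i. i \<in> I \<Longrightarrow> (\<Sum>y\<in>x ` {..<N}. v y * f i y) = 0" and y: "y \<in> x ` {..<N}"
    have "vec N (\<lambda>n. v (x n)) \<in> vec_space.col_space N V"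
      using vec_space.rank_eq_n_iff_col_space[OF V] rank by simp
    then obtain c where c: "c \<in> carrier_vec M" "V *\<^sub>v c = vec N (\<lambda>n. v (x n))"
      using vec_space.col_space_eq[OF V] V by auto
    have vx: "v (x n) = (\<Sum>j<M. f (\<zeta> j) (x n) * vec_index c j)" if "n < N" for n
    proof -
      have "v (x n) = vec_index (V *\<^sub>v c) n" using that c by simp
      then show ?thesis using that c by (simp add: V_def scalar_prod_def atLeast0LessThan)
    qed
    \<comment> \<open>A relation \<open>v\<close> is orthogonal to all columns of \<open>V\<close>. They span everything, so \<open>v\<close> is
      orthogonal to itself.\<close>
    have "(\<Sum>n<N. (v (x n))\<^sup>2) = (\<Sum>n<N. v (x n) * (\<Sum>j<M. f (\<zeta> j) (x n) * vec_index c j))"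
      using vx by (intro sum.cong) (auto simp: power2_eq_square)
    also have "\<dots> = (\<Sum>j<M. vec_index c j * (\<Sum>n<N. v (x n) * f (\<zeta> j) (x n)))"
      unfolding sum_distrib_left by (subst sum.swap) (simp add: mult_ac)
    also have "\<dots> = 0"
    proof (rule sum.neutral, intro ballI)
      fix j assume "j \<in> {..<M}"
      then have "\<zeta> j \<in> I" using \<zeta> bij_betwE by blast
      from v[OF this] show "vec_index c j * (\<Sum>n<N. v (x n) * f (\<zeta> j) (x n)) = 0"
        by (simp add: sum.reindex[OF inj])
    qed
    finally have "\<forall>n\<in>{..<N}. (v (x n))\<^sup>2 = 0" by (subst (asm) sum_nonneg_eq_0_iff) auto
    then show "v y = 0" using y by auto
  qed
  have 3: "pos_def_mat A" if indep: "lin_indep_on (\<lambda>y i. f i y) (x ` {..<N}) I"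
  proof -
    have "scalar_prod v (A *\<^sub>v v) > 0" if v: "v \<in> carrier_vec N" "v \<noteq> 0\<^sub>v N" for v
    proof -
      define s where "s i = (\<Sum>n<N. vec_index v n * f i (x n))" for i
      have "scalar_prod v (A *\<^sub>v v)
          = (\<Sum>m<N. vec_index v m * (\<Sum>n<N. (\<Sum>i\<in>I. w i * (f i (x m) * f i (x n))) * vec_index v n))"
        using v by (simp add: A_def kernel_mat_def scalar_prod_def k atLeast0LessThan)
      also have "\<dots> = (\<Sum>m<N. \<Sum>n<N. \<Sum>i\<in>I. w i * (vec_index v m * f i (x m) * (vec_index v n * f i (x n))))"
        by (simp add: sum_distrib_left sum_distrib_right mult_ac)
      also have "\<dots> = (\<Sum>m<N. \<Sum>i\<in>I. \<Sum>n<N. w i * (vec_index v m * f i (x m) * (vec_index v n * f i (x n))))"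
        by (intro sum.cong refl sum.swap)
      also have "\<dots> = (\<Sum>i\<in>I. \<Sum>m<N. \<Sum>n<N. w i * (vec_index v m * f i (x m) * (vec_index v n * f i (x n))))"
        by (rule sum.swap)
      also have "\<dots> = (\<Sum>i\<in>I. w i * (s i)\<^sup>2)"
        by (simp only: s_def power2_eq_square sum_product)
           (simp only: sum_distrib_left)
      finally have quad: "scalar_prod v (A *\<^sub>v v) = (\<Sum>i\<in>I. w i * (s i)\<^sup>2)" .
      have "\<exists>i\<in>I. s i \<noteq> 0"
      proof (rule ccontr)
        assume s0: "\<not> (\<exists>i\<in>I. s i \<noteq> 0)"
        define u where "u y = vec_index v (the_inv_into {..<N} x y)" for y
        have u: "u (x n) = vec_index v n" if "n < N" for n
          using the_inv_into_f_f[OF inj, of n] that by (simp add: u_def)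
        have "(\<Sum>y\<in>x ` {..<N}. u y * f i y) = 0" if "i \<in> I" for i
          using s0 that u by (simp add: sum.reindex[OF inj] s_def)
        then have "u (x n) = 0" if "n < N" for n
          using lin_indep_onD[OF indep, of u "x n"] that by blast
        then have "v = 0\<^sub>v N" using v u by (intro eq_vecI) auto
        then show False using v by simp
      qed
      then obtain i where "i \<in> I" "s i \<noteq> 0" by blast
      then show ?thesis unfolding quad
        using pos finI by (intro sum_pos2[of I i]) (auto simp: less_imp_le)
    qed
    moreover have "transpose_mat A = A"
      by (rule eq_matI) (auto simp: A_def kernel_mat_def k mult_ac)
    ultimately show ?thesis using A by (auto simp: pos_def_mat_def)
  qed
  show "invertible_mat A \<longleftrightarrow> vec_space.rank N V = N"
    and "invertible_mat A \<longleftrightarrow> lin_indep_on (\<lambda>y i. f i y) (x ` {..<N}) I"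
    and "invertible_mat A \<longleftrightarrow> pos_def_mat A"
    using 1 2 3 invertible_mat_if_pos_def_mat by blast+
qed

section \<open>Invertible polynomial kernel matrices and unisolvent sets\<close>

theorem proposition6:
  fixes a :: real and p N M :: nat
    and \<Omega> :: "(real ^ 'd::finite) set"
    and x :: "nat \<Rightarrow> real ^ 'd"
    and \<zeta> :: "nat \<Rightarrow> 'd \<Rightarrow> nat"
  assumes "a \<ge> 0"
    and "M = card (idx_set a p :: ('d \<Rightarrow> nat) set)"
    and "inj_on x {..<N}" and "x ` {..<N} \<subseteq> \<Omega>"
    and "N \<le> M"
    and "bij_betw \<zeta> {..<M} (idx_set a p)"
  shows "let A = kernel_mat (poly_kernel a p) N x; V = monomial_mat N M x \<zeta> in
           (invertible_mat A \<longleftrightarrow> vec_space.rank N V = N) \<and>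
           (invertible_mat A \<longrightarrow> pos_def_mat A) \<and>
           (invertible_mat A \<longleftrightarrow>
              (\<exists>X :: (real ^ 'd) set. card X = M \<and> x ` {..<N} \<subseteq> X \<and>
                 (a > 0 \<longrightarrow> unisolvent (polys p) X) \<and>
                 (a = 0 \<longrightarrow> unisolvent (homog_polys p) X)))"
proof -
  let ?I = "idx_set a p :: ('d \<Rightarrow> nat) set"
  let ?A = "kernel_mat (poly_kernel a p) N x"
  obtain w where w_pos: "\<And>\<zeta>. \<zeta> \<in> ?I \<Longrightarrow> w \<zeta> > 0"
    and w: "\<And>x y :: real ^ 'd.
      poly_kernel a p x y = (\<Sum>\<zeta>\<in>?I. w \<zeta> * (monomial \<zeta> x * monomial \<zeta> y))"
    using poly_kernel_eq_pos_sum_monomials[OF assms(1), of p, where 'd = 'd] by blast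
  note kernel = kernel_mat_feature_expansion[of ?I w "poly_kernel a p" monomial, OF w_pos w assms(6,3)]
  have indep: "lin_indep_on monomial ?I UNIV" by (rule lin_indep_monomials[OF finite_idx_set])
  have unisolvent: "(a > 0 \<longrightarrow> unisolvent (polys p) X) \<and> (a = 0 \<longrightarrow> unisolvent (homog_polys p) X)
      \<longleftrightarrow> finite X \<and> card X = M \<and> lin_indep_on monomial ?I X" for X :: "(real ^ 'd) set"
  proof (cases "a > 0")
    case True
    then have "polys p = {u. \<exists>c. \<forall>x :: real ^ 'd. u x = (\<Sum>\<zeta>\<in>?I. c \<zeta> * monomial \<zeta> x)}"
      by (simp add: polys_def idx_set_def)
    from unisolvent_iff_lin_indep_on[OF finite_idx_set indep this] True assms(2)
    show ?thesis by simp
  next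
    case False
    then have "homog_polys p = {u. \<exists>c. \<forall>x :: real ^ 'd. u x = (\<Sum>\<zeta>\<in>?I. c \<zeta> * monomial \<zeta> x)}"
      by (simp add: homog_polys_def idx_set_def)
    from unisolvent_iff_lin_indep_on[OF finite_idx_set indep this] False assms(1,2)
    show ?thesis by simp
  qed
  have "invertible_mat ?A \<longleftrightarrow> lin_indep_on (\<lambda>y \<zeta>. monomial \<zeta> y) (x ` {..<N}) ?I"
    by (rule kernel(2))
  also have "\<dots> \<longleftrightarrow>
      (\<exists>X. x ` {..<N} \<subseteq> X \<and> finite X \<and> card X = card ?I \<and> lin_indep_on monomial ?I X)"
    by (rule lin_indep_evals_iff_extension[OF finite_idx_set indep]) simp
  finally have "invertible_mat ?A \<longleftrightarrow> (\<exists>X. card X = M \<and> x ` {..<N} \<subseteq> X \<and>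
      (a > 0 \<longrightarrow> unisolvent (polys p) X) \<and> (a = 0 \<longrightarrow> unisolvent (homog_polys p) X))"
    unfolding unisolvent assms(2) by blast
  then show ?thesis
    using kernel(1,3) unfolding Let_def monomial_mat_def by blast
qed

end
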